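(* Let $K,T\ge 1$, $1\le L_R\le N_R$, and let $\mathbf{G}\in\mathbb{C}^{L_R\times N_R}$ satisfy $\operatorname{rank}(\mathbf{G})=L_R$. Let $\mathbf{J}_{\mathrm{MiLAC}}(\boldsymbol{\xi};\mathbf{G})\in\mathbb{R}^{3K\times 3K}$ be the Fisher information matrix of the observations $$\mathbf{z}_t=\mathbf{G}\mathbf{A}(\boldsymbol{\theta})\boldsymbol{\beta}\,s_t+\mathbf{G}\mathbf{n}_t,\qquad t=1,\dots,T,$$ with respect to the real parameter vector $\boldsymbol{\xi}$. Then $$\mathbf{J}_{\mathrm{MiLAC}}(\boldsymbol{\xi};\mathbf{G})=\frac{2}{\sigma^2}\,\Re\bigl\{\mathcal{J}_{\mathrm{dig}}^{\mathsf{H}}\,(\mathbf{I}_T\otimes\mathbf{P}_{\mathbf{G}})\,\mathcal{J}_{\mathrm{dig}}\bigr\},$$ where $\mathbf{P}_{\mathbf{G}}$ is the orthogonal projector of $\mathbb{C}^{N_R}$ onto $\operatorname{row}(\mathbf{G})$. When $\mathbf{P}_{\mathbf{G}}=\mathbf{I}_{N_R}$ this equals the fully-digital Fisher information matrix $\mathbf{J}_{\mathrm{dig}}(\boldsymbol{\xi})=\frac{2}{\sigma^2}\Re\{\mathcal{J}_{\mathrm{dig}}^{\mathsf{H}}\mathcal{J}_{\mathrm{dig}}\}$.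
   Context: $\mathbf{a}:\mathbb{R}\to\mathbb{C}^{N_R}$ is a differentiable steering-vector function with derivative $\dot{\mathbf{a}}$; $\theta_1,\dots,\theta_K\in\mathbb{R}$ are distinct angles, $\boldsymbol{\theta}=[\theta_1,\dots,\theta_K]^{\mathsf T}$; $\boldsymbol{\beta}=[\beta_1,\dots,\beta_K]^{\mathsf T}\in\mathbb{C}^K$ with all $\beta_k\ne 0$; $\mathbf{A}(\boldsymbol{\theta})=[\mathbf{a}(\theta_1),\dots,\mathbf{a}(\theta_K)]\in\mathbb{C}^{N_R\times K}$; $s_1,\dots,s_T\in\mathbb{C}$ is a known waveform; the noise vectors $\mathbf{n}_t\sim\mathcal{CN}(\mathbf{0},\sigma^2\mathbf{I}_{N_R})$ are circularly symmetric complex Gaussian, independent over $t$, with known $\sigma^2>0$. The unknown real parameter vector is $\boldsymbol{\xi}=[\theta_1,\dots,\theta_K,\Re\beta_1,\Im\beta_1,\dots,\Re\beta_K,\Im\beta_K]^{\mathsf T}\in\mathbb{R}^{3K}$. Let $\boldsymbol{\mu}_t=\mathbf{A}(\boldsymbol{\theta})\boldsymbol{\beta}s_t\in\mathbb{C}^{N_R}$. Then $\partial_{\theta_k}\boldsymbol{\mu}_t=s_t\beta_k\dot{\mathbf{a}}(\theta_k)$, $\partial_{\Re\beta_k}\boldsymbol{\mu}_t=s_t\mathbf{a}(\theta_k)$, $\partial_{\Im\beta_k}\boldsymbol{\mu}_t=js_t\mathbf{a}(\theta_k)$. The digital Jacobian $\mathcal{J}_{\mathrm{dig}}\in\mathbb{C}^{TN_R\times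 3K}$ is the vertical stack over $t=1,\dots,T$ of the matrices $\partial\boldsymbol{\mu}_t/\partial\boldsymbol{\xi}\in\mathbb{C}^{N_R\times 3K}$. Convention: $\operatorname{row}(\mathbf{G}):=\operatorname{col}(\mathbf{G}^{\mathsf H})\subseteq\mathbb{C}^{N_R}$. The symbol $\otimes$ is the Kronecker product. *)

theory Defs
  imports "HOL-Probability.Probability"
begin

definition hinner :: "complex^'n \<Rightarrow> complex^'n \<Rightarrow> complex" where
  "hinner x y = (\<Sum>i\<in>UNIV. cnj (x $ i) * y $ i)"

definition conj_transpose :: "complex^'n^'m \<Rightarrow> complex^'m^'n" where
  "conj_transpose A = map_matrix cnj (transpose A)"

definition col_space :: "complex^'n^'m \<Rightarrow> (complex^'m) set" where
  "col_space A = vec.span (columns A)"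

text \<open>The row space is the column space of the conjugate transpose, not of the transpose.\<close>

definition row_space :: "complex^'n^'m \<Rightarrow> (complex^'n) set" where
  "row_space A = col_space (conj_transpose A)"

definition orthogonal_projector :: "(complex^'n) set \<Rightarrow> complex^'n^'n" where
  "orthogonal_projector S =
    (THE P. \<forall>x. P *v x \<in> S \<and> (\<forall>y\<in>S. hinner y (x - P *v x) = 0))"

text \<open>Rows and columns of a Kronecker product are indexed by pairs, the first component
  being the block index.\<close>

definition kronecker ::
  "complex^'n^'m \<Rightarrow> complex^'q^'p \<Rightarrow> complex^('n \<times> 'q)^('m \<times> 'p)" where
  "kronecker A B = (\<chi> r c. A $ fst r $ fst c * B $ snd r $ snd c)"

text \<open>The density with respect to Lebesgue measure on the underlying real space of dimension
  \<open>2 * CARD('n)\<close>, for a positive definite Hermitian covariance matrix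
  \<open>\<Gamma> = E[(x - m) (x - m)\<^sup>H]\<close>.\<close>

definition complex_normal_density ::
  "complex^'n \<Rightarrow> complex^'n^'n \<Rightarrow> complex^'n \<Rightarrow> real" where
  "complex_normal_density m \<Gamma> x =
    exp (- Re (hinner (x - m) (matrix_inv \<Gamma> *v (x - m)))) / (pi ^ CARD('n) * Re (det \<Gamma>))"

text \<open>A statistical model is a family \<open>P\<close> of laws, indexed by a real parameter vector.
  A Lebesgue density is only determined almost everywhere, so the pointwise derivatives in the
  score would depend on the chosen versions. The continuous version is unique if it exists; it
  is the one used here.\<close>

definition is_continuous_density :: "'o::euclidean_space measure \<Rightarrow> ('o \<Rightarrow> real) \<Rightarrow> bool" where
  "is_continuous_density P f \<longleftrightarrow>
    continuous_on UNIV f \<and> (\<forall>x. 0 \<le> f x) \<and> P = density lborel (\<lambda>x. ennreal (f x))"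

definition likelihood :: "'o::euclidean_space measure \<Rightarrow> 'o \<Rightarrow> real" where
  "likelihood P = (THE f. is_continuous_density P f)"

definition score ::
  "(real^'p \<Rightarrow> 'o::euclidean_space measure) \<Rightarrow> real^'p \<Rightarrow> 'o \<Rightarrow> real^'p" where
  "score P \<xi> x = (\<chi> i. deriv (\<lambda>h. ln (likelihood (P (\<xi> + h *\<^sub>R axis i 1)) x)) 0)"

definition fisher_information_matrix ::
  "(real^'p \<Rightarrow> 'o::euclidean_space measure) \<Rightarrow> real^'p \<Rightarrow> real^'p^'p" where
  "fisher_information_matrix P \<xi> =
    (\<chi> i j. integral\<^sup>L (P \<xi>) (\<lambda>x. score P \<xi> x $ i * score P \<xi> x $ j))"

text \<open>The following excludes that the values above are the conventional ones of \<open>THE\<close>,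
  \<open>deriv\<close>, \<open>ln\<close> and the Bochner integral outside their domains.\<close>

definition fisher_regular ::
  "(real^'p \<Rightarrow> 'o::euclidean_space measure) \<Rightarrow> real^'p \<Rightarrow> bool" where
  "fisher_regular P \<xi> \<longleftrightarrow>
    (\<forall>\<eta>. \<exists>!f. is_continuous_density (P \<eta>) f) \<and>
    (\<forall>\<eta> x. 0 < likelihood (P \<eta>) x) \<and>
    (\<forall>x i. (\<lambda>h. ln (likelihood (P (\<xi> + h *\<^sub>R axis i 1)) x)) differentiable (at 0)) \<and>
    (\<forall>i j. integrable (P \<xi>) (\<lambda>x. score P \<xi> x $ i * score P \<xi> x $ j))"

text \<open>The real parameter vector has one coordinate for each element of this type, in place of the
  positions \<open>1, \<dots>, 3K\<close> in a linear ordering.\<close>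

datatype 'k param = Angle 'k | ReGain 'k | ImGain 'k

lemma UNIV_param: "(UNIV :: 'k param set) = range Angle \<union> range ReGain \<union> range ImGain"
proof -
  have "x \<in> range Angle \<union> range ReGain \<union> range ImGain" for x :: "'k param"
    by (cases x) simp_all
  then show ?thesis by blast
qed

instance param :: (finite) finite
proof
  have "finite (range Angle \<union> range ReGain \<union> range ImGain :: 'a param set)"
    by simp
  then show "finite (UNIV :: 'a param set)"
    by (simp only: UNIV_param)
qed

lemma CARD_param: "CARD('k::finite param) = 3 * CARD('k)"
proof -
  have "card (range (Angle :: 'k \<Rightarrow> _)) = CARD('k)" "card (range (ReGain :: 'k \<Rightarrow> _)) = CARD('k)"
    "card (range (ImGain :: 'k \<Rightarrow> _)) = CARD('k)"
    by (auto intro!: card_image injI)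
  moreover have "range (Angle :: 'k \<Rightarrow> _) \<inter> range ReGain = {}"
    "(range (Angle :: 'k \<Rightarrow> _) \<union> range ReGain) \<inter> range ImGain = {}"
    by auto
  ultimately show ?thesis
    unfolding UNIV_param by (simp add: card_Un_disjoint)
qed

definition angles :: "real^('k::finite param) \<Rightarrow> real^'k" where
  "angles \<xi> = (\<chi> k. \<xi> $ Angle k)"

definition gains :: "real^('k::finite param) \<Rightarrow> complex^'k" where
  "gains \<xi> = (\<chi> k. Complex (\<xi> $ ReGain k) (\<xi> $ ImGain k))"

definition steering_matrix :: "(real \<Rightarrow> complex^'n) \<Rightarrow> real^'k \<Rightarrow> complex^'k^'n" where
  "steering_matrix a \<theta> = (\<chi> i k. a (\<theta> $ k) $ i)"

definition mean_signal ::
  "(real \<Rightarrow> complex^'n) \<Rightarrow> ('t \<Rightarrow> complex) \<Rightarrow> real^('k::finite param) \<Rightarrow> 't \<Rightarrow> complex^'n" where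
  "mean_signal a s \<xi> t = s t *s (steering_matrix a (angles \<xi>) *v gains \<xi>)"

text \<open>The vertical stack over \<open>t\<close> of the partial derivatives of the mean signals; its rows are
  indexed by pairs \<open>(t, i)\<close> of a snapshot and an antenna.\<close>

definition digital_jacobian ::
  "(real \<Rightarrow> complex^'n) \<Rightarrow> ('t::finite \<Rightarrow> complex) \<Rightarrow> real^('k::finite param)
    \<Rightarrow> complex^('k param)^('t \<times> 'n)" where
  "digital_jacobian a s \<xi> =
    (\<chi> r p. vector_derivative (\<lambda>h. mean_signal a s (\<xi> + h *\<^sub>R axis p 1) (fst r)) (at 0) $ snd r)"

lemma mean_signal_nth:
  "mean_signal a s \<xi> t $ i =
    s t * (\<Sum>k\<in>UNIV. a (\<xi> $ Angle k) $ i * Complex (\<xi> $ ReGain k) (\<xi> $ ImGain k))"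
  by (simp add: mean_signal_def steering_matrix_def angles_def gains_def matrix_vector_mult_def)

lemma mean_signal_shift:
  assumes "\<And>j. j \<noteq> k \<Longrightarrow>
    \<eta> $ Angle j = \<xi> $ Angle j \<and> \<eta> $ ReGain j = \<xi> $ ReGain j \<and> \<eta> $ ImGain j = \<xi> $ ImGain j"
  shows "mean_signal a s \<eta> t = mean_signal a s \<xi> t
    + s t *s ((gains \<eta> $ k) *s a (\<eta> $ Angle k) - (gains \<xi> $ k) *s a (\<xi> $ Angle k))"
proof -
  have "(\<Sum>j\<in>UNIV - {k}. a (\<eta> $ Angle j) $ i * Complex (\<eta> $ ReGain j) (\<eta> $ ImGain j)) =
      (\<Sum>j\<in>UNIV - {k}. a (\<xi> $ Angle j) $ i * Complex (\<xi> $ ReGain j) (\<xi> $ ImGain j))" for i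
    by (rule sum.cong) (use assms in auto)
  then show ?thesis
    by (simp add: vec_eq_iff mean_signal_nth gains_def sum.remove[of UNIV k] algebra_simps)
qed

lemma bounded_linear_vector_smult: "bounded_linear (\<lambda>x :: complex^'n. c *s x)"
  by (rule linear_conv_bounded_linear[THEN iffD1], rule linearI)
    (simp_all add: vec_eq_iff algebra_simps)

lemma digital_jacobian_Angle:
  assumes "(a has_vector_derivative a') (at (\<xi> $ Angle k))"
  shows "digital_jacobian a s \<xi> $ (t, i) $ Angle k = s t * (gains \<xi> $ k) * a' $ i"
proof -
  have *: "mean_signal a s (\<xi> + h *\<^sub>R axis (Angle k) 1) t = mean_signal a s \<xi> t
      + s t *s ((gains \<xi> $ k) *s a (\<xi> $ Angle k + h) - (gains \<xi> $ k) *s a (\<xi> $ Angle k))" for h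
    by (subst mean_signal_shift[of k _ \<xi>]) (auto simp: gains_def axis_def)
  have "((\<lambda>h. a (\<xi> $ Angle k + h)) has_vector_derivative a') (at 0)"
  proof -
    have "((\<lambda>h. \<xi> $ Angle k + h) has_vector_derivative 1) (at 0)"
      unfolding has_real_derivative_iff_has_vector_derivative[symmetric]
      by (auto intro!: derivative_eq_intros)
    from vector_diff_chain_at[OF this, of a a'] assms show ?thesis
      by (simp add: o_def)
  qed
  then have "((\<lambda>h. mean_signal a s (\<xi> + h *\<^sub>R axis (Angle k) 1) t) has_vector_derivative
      s t *s ((gains \<xi> $ k) *s a')) (at 0)"
    unfolding * by (auto intro!: derivative_eq_intros
      bounded_linear.has_vector_derivative[OF bounded_linear_vector_smult])
  then show ?thesis
    by (simp add: digital_jacobian_def vector_derivative_at mult.assoc)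
qed

lemma digital_jacobian_ReGain:
  "digital_jacobian a s \<xi> $ (t, i) $ ReGain k = s t * a (\<xi> $ Angle k) $ i"
proof -
  have *: "mean_signal a s (\<xi> + h *\<^sub>R axis (ReGain k) 1) t = mean_signal a s \<xi> t
      + h *\<^sub>R (s t *s a (\<xi> $ Angle k))" for h
    by (subst mean_signal_shift[of k _ \<xi>])
      (auto simp: vec_eq_iff gains_def axis_def complex_eq_iff algebra_simps)
  have "((\<lambda>h. mean_signal a s (\<xi> + h *\<^sub>R axis (ReGain k) 1) t) has_vector_derivative
      s t *s a (\<xi> $ Angle k)) (at 0)"
    unfolding * by (auto intro!: derivative_eq_intros)
  then show ?thesis
    by (simp add: digital_jacobian_def vector_derivative_at)
qed

lemma digital_jacobian_ImGain:
  "digital_jacobian a s \<xi> $ (t, i) $ ImGain k = \<i> * s t * a (\<xi> $ Angle k) $ i"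
proof -
  have *: "mean_signal a s (\<xi> + h *\<^sub>R axis (ImGain k) 1) t = mean_signal a s \<xi> t
      + h *\<^sub>R ((\<i> * s t) *s a (\<xi> $ Angle k))" for h
    by (subst mean_signal_shift[of k _ \<xi>])
      (auto simp: vec_eq_iff gains_def axis_def complex_eq_iff algebra_simps)
  have "((\<lambda>h. mean_signal a s (\<xi> + h *\<^sub>R axis (ImGain k) 1) t) has_vector_derivative
      (\<i> * s t) *s a (\<xi> $ Angle k)) (at 0)"
    unfolding * by (auto intro!: derivative_eq_intros)
  then show ?thesis
    by (simp add: digital_jacobian_def vector_derivative_at)
qed

definition digital_law ::
  "'w measure \<Rightarrow> ('t::finite \<Rightarrow> 'w \<Rightarrow> complex^'n) \<Rightarrow> (real \<Rightarrow> complex^'n) \<Rightarrow> ('t \<Rightarrow> complex)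
    \<Rightarrow> real^('k::finite param) \<Rightarrow> (complex^'n^'t) measure" where
  "digital_law M n a s \<xi> = distr M lborel (\<lambda>\<omega>. \<chi> t. mean_signal a s \<xi> t + n t \<omega>)"

definition milac_law ::
  "'w measure \<Rightarrow> ('t::finite \<Rightarrow> 'w \<Rightarrow> complex^'n) \<Rightarrow> (real \<Rightarrow> complex^'n) \<Rightarrow> ('t \<Rightarrow> complex)
    \<Rightarrow> complex^'n^'l \<Rightarrow> real^('k::finite param) \<Rightarrow> (complex^'l^'t) measure" where
  "milac_law M n a s G \<xi> =
    distr M lborel (\<lambda>\<omega>. \<chi> t. G *v mean_signal a s \<xi> t + G *v n t \<omega>)"

end

theory Submission
  imports Defs
begin

text \<open>
  Stack the noise vectors into one isotropic Gaussian vector \<open>N\<close>, so that the observation is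
  \<open>A (\<mu> + N)\<close> with \<open>A\<close> acting as \<open>G\<close> on each block. With the pseudo-inverse
  \<open>R = G\<^sup>H (G G\<^sup>H)\<^sup>-\<^sup>1\<close> acting blockwise as \<open>B\<close>, the map \<open>B \<circ> A\<close> is the orthogonal
  projection given by \<open>P\<^sub>G = R G\<close>. By Pythagoras the density of \<open>N\<close> splits into a factor depending on
  \<open>x - B (A x)\<close> and one depending on \<open>A x\<close>, and Fubini together with translation invariance shows
  that \<open>A N\<close> has a density proportional to \<open>exp (- |B y|\<^sup>2 / \<sigma>\<^sup>2)\<close>; the normalising constant is
  irrelevant for the score. The \<open>i\<close>-th score is therefore \<open>2 / \<sigma>\<^sup>2\<close> times the inner product of \<open>N\<close>
  with the projection of \<open>\<partial>\<^sub>i \<mu>\<close>, and the second moments of \<open>N\<close> give the Fisher matrix. The digital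
  model is the case \<open>G = I\<close>.
\<close>

subsection \<open>Linear images of random vectors with a density\<close>

lemma nn_integral_lborel_translate:
  fixes f :: "'a::euclidean_space \<Rightarrow> ennreal"
  assumes [measurable]: "f \<in> borel_measurable borel"
  shows "(\<integral>\<^sup>+x. f (x + t) \<partial>lborel) = (\<integral>\<^sup>+x. f x \<partial>lborel)"
proof -
  have "(\<integral>\<^sup>+x. f x \<partial>lborel) = (\<integral>\<^sup>+x. f x \<partial>distr lborel borel ((+) t))"
    by (simp add: lborel_distr_plus)
  also have "\<dots> = (\<integral>\<^sup>+x. f (x + t) \<partial>lborel)"
    by (simp add: nn_integral_distr add.commute)
  finally show ?thesis ..
qed

lemma borel_measurable_linear:
  fixes A :: "'a::euclidean_space \<Rightarrow> 'b::euclidean_space"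
  shows "linear A \<Longrightarrow> A \<in> borel_measurable borel"
  by (intro borel_measurable_continuous_onI linear_continuous_on) (simp add: linear_conv_bounded_linear)

text \<open>Both sides equal the double integral of
  \<open>h (A x) * e (x - B (A x)) * \<phi> (y + A x)\<close>. Translating \<open>x\<close> by
  \<open>B (- y)\<close> moves \<open>A x\<close> by \<open>- y\<close> and, since \<open>A\<close>
  undoes \<open>B\<close>, fixes \<open>x - B (A x)\<close>; so the shift passes from
  \<open>\<phi>\<close> to \<open>h\<close>, and a reflection in \<open>y\<close> isolates the
  integral of \<open>h\<close>. The cross-multiplied form avoids dividing by integrals that may be
  infinite.\<close>

lemma nn_integral_linear_projection:
  fixes A :: "'a::euclidean_space \<Rightarrow> 'b::euclidean_space"
  assumes A: "linear A" and B: "linear B" and AB: "\<And>y. A (B y) = y"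
    and [measurable]: "e \<in> borel_measurable borel" "h \<in> borel_measurable borel"
      "\<phi> \<in> borel_measurable borel"
  shows "(\<integral>\<^sup>+x. h (A x) * e (x - B (A x)) \<partial>lborel) * (\<integral>\<^sup>+y. \<phi> y \<partial>lborel)
    = (\<integral>\<^sup>+y. h y \<partial>lborel) * (\<integral>\<^sup>+x. \<phi> (A x) * e (x - B (A x)) \<partial>lborel)"
proof -
  note [measurable] = borel_measurable_linear[OF A] borel_measurable_linear[OF B]
  have shift: "A (x + B (- y)) = A x - y" "x + B (- y) - B (A x - y) = x - B (A x)" for x y
    by (simp_all add: linear_add[OF A] linear_diff[OF B] linear_neg[OF B] linear_neg[OF A] linear_diff[OF A] AB)
  have "(\<integral>\<^sup>+x. h (A x) * e (x - B (A x)) \<partial>lborel) * (\<integral>\<^sup>+y. \<phi> y \<partial>lborel)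
      = (\<integral>\<^sup>+x. h (A x) * e (x - B (A x)) * (\<integral>\<^sup>+y. \<phi> (y + A x) \<partial>lborel) \<partial>lborel)"
    by (simp add: nn_integral_lborel_translate nn_integral_multc)
  also have "\<dots> = (\<integral>\<^sup>+x. \<integral>\<^sup>+y. h (A x) * e (x - B (A x)) * \<phi> (y + A x) \<partial>lborel \<partial>lborel)"
    by (simp add: nn_integral_cmult)
  also have "\<dots> = (\<integral>\<^sup>+y. \<integral>\<^sup>+x. h (A x) * e (x - B (A x)) * \<phi> (y + A x) \<partial>lborel \<partial>lborel)"
    by (rule lborel_pair.Fubini'[symmetric]) simp
  also have "\<dots> = (\<integral>\<^sup>+y. \<integral>\<^sup>+x. h (A x - y) * e (x - B (A x)) * \<phi> (A x) \<partial>lborel \<partial>lborel)"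
  proof (rule nn_integral_cong)
    fix y :: 'b
    have "(\<integral>\<^sup>+x. h (A x) * e (x - B (A x)) * \<phi> (y + A x) \<partial>lborel)
      = (\<integral>\<^sup>+x. h (A (x + B (- y))) * e ((x + B (- y)) - B (A (x + B (- y))))
          * \<phi> (y + A (x + B (- y))) \<partial>lborel)"
      by (rule nn_integral_lborel_translate[symmetric]) simp
    then show "(\<integral>\<^sup>+x. h (A x) * e (x - B (A x)) * \<phi> (y + A x) \<partial>lborel)
      = (\<integral>\<^sup>+x. h (A x - y) * e (x - B (A x)) * \<phi> (A x) \<partial>lborel)"
      unfolding shift by simp
  qed
  also have "\<dots> = (\<integral>\<^sup>+x. \<integral>\<^sup>+y. h (A x - y) * e (x - B (A x)) * \<phi> (A x) \<partial>lborel \<partial>lborel)"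
    by (rule lborel_pair.Fubini') simp
  also have "\<dots> = (\<integral>\<^sup>+x. (\<integral>\<^sup>+y. h y \<partial>lborel) * (\<phi> (A x) * e (x - B (A x))) \<partial>lborel)"
  \<comment> \<open>For fixed \<open>x\<close> the map sending \<open>y\<close> to
    \<open>A x - y\<close> is a reflection followed by a translation, so it preserves Lebesgue
    measure.\<close>
  proof (rule nn_integral_cong)
    fix x :: 'a
    have "(\<integral>\<^sup>+y. h (A x - y) \<partial>lborel) = (\<integral>\<^sup>+y. h y \<partial>lborel)"
    proof -
      have "(\<integral>\<^sup>+y. h y \<partial>lborel)
          = (\<integral>\<^sup>+y. h y \<partial>density (distr lborel borel (\<lambda>y. A x + (- 1) *\<^sub>R y)) (\<lambda>_. 1))"
        using lborel_affine[of "- 1" "A x"] by simp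
      also have "\<dots> = (\<integral>\<^sup>+y. h (A x - y) \<partial>lborel)"
        by (simp add: nn_integral_distr density_1)
      finally show ?thesis ..
    qed
    then show "(\<integral>\<^sup>+y. h (A x - y) * e (x - B (A x)) * \<phi> (A x) \<partial>lborel)
      = (\<integral>\<^sup>+y. h y \<partial>lborel) * (\<phi> (A x) * e (x - B (A x)))"
      by (simp add: nn_integral_multc mult.assoc) (simp add: mult_ac)
  qed
  also have "\<dots> = (\<integral>\<^sup>+y. h y \<partial>lborel) * (\<integral>\<^sup>+x. \<phi> (A x) * e (x - B (A x)) \<partial>lborel)"
    by (simp add: nn_integral_cmult)
  finally show ?thesis .
qed

text \<open>With \<open>h\<close> equal to \<open>\<phi>\<close> times the indicator of
  \<open>S\<close>, the preceding identity says that the probability of \<open>A X\<close> lying in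
  \<open>S\<close>, times the total mass \<open>Z\<close> of \<open>\<phi>\<close>, is the integral
  of \<open>\<phi>\<close> over \<open>S\<close>, because the density of \<open>X\<close> has mass
  one. That \<open>Z\<close> is finite is not assumed but derived from the same identity.\<close>

lemma distributed_linear_projection:
  fixes A :: "'a::euclidean_space \<Rightarrow> 'b::euclidean_space" and e :: "'a \<Rightarrow> real" and \<phi> :: "'b \<Rightarrow> real"
  assumes "prob_space M"
    and A: "linear A" and B: "linear B" and AB: "\<And>y. A (B y) = y"
    and X: "distributed M lborel X (\<lambda>x. ennreal (e (x - B (A x)) * \<phi> (A x)))"
    and e: "e \<in> borel_measurable borel" "\<And>x. 0 \<le> e x"
    and \<phi>: "continuous_on UNIV \<phi>" "\<And>y. 0 < \<phi> y"
  shows "integrable lborel \<phi>" and "0 < integral\<^sup>L lborel \<phi>"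
    and "distributed M lborel (\<lambda>\<omega>. A (X \<omega>)) (\<lambda>y. ennreal (\<phi> y / integral\<^sup>L lborel \<phi>))"
proof -
  interpret prob_space M by fact
  note [measurable] = borel_measurable_linear[OF A] borel_measurable_linear[OF B] e(1)
  have [measurable]: "\<phi> \<in> borel_measurable borel"
    using \<phi>(1) by (rule borel_measurable_continuous_onI)
  have [measurable]: "X \<in> borel_measurable M"
    using distributed_measurable[OF X] by simp
  have \<phi>_nonneg: "0 \<le> \<phi> y" for y
    using \<phi>(2)[of y] by simp
  define Z where "Z = (\<integral>\<^sup>+y. ennreal (\<phi> y) \<partial>lborel)"
  have one: "(\<integral>\<^sup>+x. ennreal (e (x - B (A x)) * \<phi> (A x)) \<partial>lborel) = 1"
    using distributed_nn_integral[OF X, of "\<lambda>_. 1"] by (simp add: emeasure_space_1)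
  have main: "emeasure M {\<omega>\<in>space M. A (X \<omega>) \<in> S} * Z = (\<integral>\<^sup>+y. ennreal (\<phi> y) * indicator S y \<partial>lborel)"
    if [measurable]: "S \<in> sets borel" for S
  proof -
    have "emeasure M {\<omega>\<in>space M. A (X \<omega>) \<in> S}
        = (\<integral>\<^sup>+\<omega>. indicator {\<omega>\<in>space M. A (X \<omega>) \<in> S} \<omega> \<partial>M)"
      by (rule nn_integral_indicator[symmetric]) measurable
    also have "\<dots> = (\<integral>\<^sup>+\<omega>. indicator S (A (X \<omega>)) \<partial>M)"
      by (rule nn_integral_cong) (simp add: indicator_def)
    also have "\<dots> = (\<integral>\<^sup>+x. ennreal (e (x - B (A x)) * \<phi> (A x)) * indicator S (A x) \<partial>lborel)"
      by (rule distributed_nn_integral[OF X, symmetric]) simp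
    also have "\<dots> = (\<integral>\<^sup>+x. ennreal (\<phi> (A x)) * indicator S (A x) * ennreal (e (x - B (A x))) \<partial>lborel)"
      by (simp add: ennreal_mult e \<phi>_nonneg mult_ac)
    finally show ?thesis
      using nn_integral_linear_projection[OF A B AB, of "\<lambda>x. ennreal (e x)"
          "\<lambda>y. ennreal (\<phi> y) * indicator S y" "\<lambda>y. ennreal (\<phi> y)"] one
      by (simp add: Z_def ennreal_mult e \<phi>_nonneg mult_ac)
  qed
  \<comment> \<open>A test set of positive measure that is also compact, so that the continuous
    positive function \<open>\<phi>\<close> has a positive finite integral over it.\<close>
  define C where "C = cbox (0::'b) One"
  have [measurable]: "C \<in> sets borel"
    by (simp add: C_def)
  have C_pos: "(\<integral>\<^sup>+y. ennreal (\<phi> y) * indicator C y \<partial>lborel) \<noteq> 0"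
  proof
    assume "(\<integral>\<^sup>+y. ennreal (\<phi> y) * indicator C y \<partial>lborel) = 0"
    then have "emeasure lborel {y. ennreal (\<phi> y) * indicator C y \<noteq> 0} = 0"
      by (simp add: nn_integral_0_iff)
    also have "{y. ennreal (\<phi> y) * indicator C y \<noteq> 0} = C"
      using \<phi>(2) by (force simp: indicator_def ennreal_eq_0_iff not_le[symmetric])
    finally show False
      by (simp add: C_def emeasure_lborel_cbox_eq)
  qed
  have C_finite: "(\<integral>\<^sup>+y. ennreal (\<phi> y) * indicator C y \<partial>lborel) \<noteq> \<infinity>"
  proof -
    have "integrable lborel (\<lambda>y. indicator C y *\<^sub>R \<phi> y)"
      using continuous_on_subset[OF \<phi>(1)]
      by (intro borel_integrable_compact) (auto simp: C_def)
    then have "(\<integral>\<^sup>+y. ennreal (indicator C y *\<^sub>R \<phi> y) \<partial>lborel) \<noteq> \<infinity>"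
      by (subst nn_integral_eq_integral) (auto simp: \<phi>_nonneg)
    also have "(\<integral>\<^sup>+y. ennreal (indicator C y *\<^sub>R \<phi> y) \<partial>lborel) = (\<integral>\<^sup>+y. ennreal (\<phi> y) * indicator C y \<partial>lborel)"
      by (intro nn_integral_cong) (simp add: indicator_def)
    finally show ?thesis .
  qed
  \<comment> \<open>If \<open>Z\<close> were infinite, the left side of \<open>main\<close> for
    \<open>C\<close> would be 0 or infinite; if \<open>Z\<close> were 0, it would be 0. The integral
    over \<open>C\<close> is neither.\<close>
  have Z_finite: "Z \<noteq> \<infinity>"
    using main[of C] C_pos C_finite by (auto simp: ennreal_mult_top split: if_splits)
  have Z_pos: "Z \<noteq> 0"
    using main[of C] C_pos by auto
  show int: "integrable lborel \<phi>"
    using Z_finite by (intro integrableI_nonneg) (auto simp: Z_def \<phi>_nonneg less_top)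
  have Z: "Z = ennreal (integral\<^sup>L lborel \<phi>)"
    unfolding Z_def using int by (intro nn_integral_eq_integral) (auto simp: \<phi>_nonneg)
  show pos: "0 < integral\<^sup>L lborel \<phi>"
    using Z_pos by (simp add: Z) (metis ennreal_neg linorder_not_less)
  show "distributed M lborel (\<lambda>\<omega>. A (X \<omega>)) (\<lambda>y. ennreal (\<phi> y / integral\<^sup>L lborel \<phi>))"
    unfolding distributed_def
  proof (intro conjI measure_eqI)
    fix S assume "S \<in> sets (distr M lborel (\<lambda>\<omega>. A (X \<omega>)))"
    then have [measurable]: "S \<in> sets borel" by simp
    have "emeasure (distr M lborel (\<lambda>\<omega>. A (X \<omega>))) S * Z
        = (\<integral>\<^sup>+y. ennreal (\<phi> y) * indicator S y \<partial>lborel)"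
      using main[of S] by (simp add: emeasure_distr vimage_def Int_def conj_commute)
    also have "\<dots> = (\<integral>\<^sup>+y. ennreal (\<phi> y / integral\<^sup>L lborel \<phi>) * indicator S y * Z \<partial>lborel)"
      using pos by (intro nn_integral_cong)
        (simp add: Z \<phi>_nonneg indicator_def flip: ennreal_mult'')
    also have "\<dots> = emeasure (density lborel (\<lambda>y. ennreal (\<phi> y / integral\<^sup>L lborel \<phi>))) S * Z"
      by (simp add: emeasure_density nn_integral_multc)
    finally show "emeasure (distr M lborel (\<lambda>\<omega>. A (X \<omega>))) S
        = emeasure (density lborel (\<lambda>y. ennreal (\<phi> y / integral\<^sup>L lborel \<phi>))) S"
      using Z_pos Z_finite by (simp add: ennreal_mult_cancel_left mult.commute[of _ Z])
  qed simp_all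
qed

subsection \<open>Independent random vectors\<close>

lemma borel_measurable_vec_lambda:
  "(\<lambda>f. \<chi> t. f t) \<in> (\<Pi>\<^sub>M t\<in>UNIV. lborel :: 'a::euclidean_space measure) \<rightarrow>\<^sub>M (borel :: ('a^'t) measure)"
proof (subst borel_measurable_euclidean_space, intro ballI)
  fix b :: "'a^'t" assume "b \<in> Basis"
  then obtain t u where b: "b = axis t u" by (auto simp: Basis_vec_def)
  have "(\<lambda>f. f t \<bullet> u) \<in> borel_measurable (\<Pi>\<^sub>M t\<in>UNIV. lborel :: 'a measure)"
    by measurable
  then show "(\<lambda>f. (\<chi> t. f t) \<bullet> b) \<in> borel_measurable (\<Pi>\<^sub>M t\<in>UNIV. lborel :: 'a measure)"
    by (simp add: b inner_axis)
qed

text \<open>Lebesgue measure is determined by its values on boxes. As the basis vectors are the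
  \<open>axis t b\<close>, a box of vectors is a product of boxes, and its volume is the product of
  theirs. This lets densities on product spaces be moved to \<open>'a^'t\<close>.\<close>

lemma lborel_vec_eq_PiM:
  "(lborel :: ('a::euclidean_space^'t) measure)
    = distr (\<Pi>\<^sub>M t\<in>UNIV. lborel) borel (\<lambda>f. \<chi> t. f t)"
proof (rule lborel_eqI)
  interpret finite_product_sigma_finite "\<lambda>_::'t. lborel :: 'a measure" UNIV
    by standard simp
  note [measurable] = borel_measurable_vec_lambda
  show "sets (distr (\<Pi>\<^sub>M t\<in>UNIV. lborel) borel (\<lambda>f. \<chi> t. f t)) = (sets borel :: ('a^'t) set set)"
    by simp
  fix l u :: "'a^'t" assume le: "\<And>b. b \<in> Basis \<Longrightarrow> l \<bullet> b \<le> u \<bullet> b"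
  have le': "l $ t \<bullet> b \<le> u $ t \<bullet> b" if "b \<in> Basis" for t b
    using le[of "axis t b"] that by (auto simp: Basis_vec_def inner_axis)
  have inj: "inj_on (\<lambda>(t, b). axis t b :: 'a^'t) (UNIV \<times> Basis)"
    by (auto simp: inj_on_def axis_eq_axis)
  have Basis: "(Basis :: ('a^'t) set) = (\<lambda>(t, b). axis t b) ` (UNIV \<times> Basis)"
    by (auto simp: Basis_vec_def)
  have "emeasure (distr (\<Pi>\<^sub>M t\<in>UNIV. lborel) borel (\<lambda>f. \<chi> t. f t)) (box l u)
      = emeasure (\<Pi>\<^sub>M t\<in>UNIV. lborel) (Pi\<^sub>E UNIV (\<lambda>t. box (l $ t) (u $ t)))"
  proof (subst emeasure_distr)
    show "emeasure (\<Pi>\<^sub>M t\<in>UNIV. lborel) ((\<lambda>f. \<chi> t. f t) -` box l u \<inter> space (\<Pi>\<^sub>M t\<in>UNIV. lborel))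
      = emeasure (\<Pi>\<^sub>M t\<in>UNIV. lborel) (Pi\<^sub>E UNIV (\<lambda>t. box (l $ t) (u $ t)))"
      by (rule arg_cong[where f="emeasure _"])
        (auto simp: space_PiM PiE_def Pi_def mem_box Basis inner_axis)
  qed simp_all
  also have "\<dots> = (\<Prod>t\<in>UNIV. emeasure lborel (box (l $ t) (u $ t)))"
    by (rule measure_times) simp
  also have "\<dots> = (\<Prod>t\<in>UNIV. ennreal (\<Prod>b\<in>Basis. (u $ t - l $ t) \<bullet> b))"
    using le' by (intro prod.cong refl emeasure_lborel_box)
  also have "\<dots> = ennreal (\<Prod>t\<in>UNIV. \<Prod>b\<in>Basis. (u $ t - l $ t) \<bullet> b)"
    using le' by (intro prod_ennreal prod_nonneg) (simp add: inner_diff_left)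
  also have "(\<Prod>t\<in>UNIV. \<Prod>b\<in>Basis. (u $ t - l $ t) \<bullet> b) = (\<Prod>b\<in>Basis. (u - l) \<bullet> b)"
    by (simp add: Basis prod.reindex[OF inj, unfolded case_prod_unfold] case_prod_unfold inner_axis prod.cartesian_product)
  finally show "emeasure (distr (\<Pi>\<^sub>M t\<in>UNIV. lborel) borel (\<lambda>f. \<chi> t. f t)) (box l u)
      = ennreal (\<Prod>b\<in>Basis. (u - l) \<bullet> b)" .
qed

text \<open>A product of sigma-finite measures is determined by its values on rectangles, and there
  the integral of a product of functions of separate coordinates factorises.\<close>

lemma (in product_sigma_finite) PiM_density:
  assumes I: "finite I" and [measurable]: "\<And>i. i \<in> I \<Longrightarrow> f i \<in> borel_measurable (M i)"
    and "\<And>i. sigma_finite_measure (density (M i) (f i))"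
  shows "(\<Pi>\<^sub>M i\<in>I. density (M i) (f i)) = density (PiM I M) (\<lambda>x. \<Prod>i\<in>I. f i (x i))"
proof (rule sym)
  interpret D: product_sigma_finite "\<lambda>i. density (M i) (f i)"
    using assms(3) by (simp add: product_sigma_finite_def)
  show "density (PiM I M) (\<lambda>x. \<Prod>i\<in>I. f i (x i)) = (\<Pi>\<^sub>M i\<in>I. density (M i) (f i))"
  proof (rule D.PiM_eqI[OF I])
    show "sets (density (PiM I M) (\<lambda>x. \<Prod>i\<in>I. f i (x i))) = sets (\<Pi>\<^sub>M i\<in>I. density (M i) (f i))"
      by (simp cong: sets_PiM_cong)
    fix A assume "\<And>i. i \<in> I \<Longrightarrow> A i \<in> sets (density (M i) (f i))"
    then have [measurable]: "\<And>i. i \<in> I \<Longrightarrow> A i \<in> sets (M i)" by simp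
    have "emeasure (density (PiM I M) (\<lambda>x. \<Prod>i\<in>I. f i (x i))) (Pi\<^sub>E I A)
        = (\<integral>\<^sup>+x. (\<Prod>i\<in>I. f i (x i)) * indicator (Pi\<^sub>E I A) x \<partial>PiM I M)"
      using I by (intro emeasure_density) (auto intro!: sets_PiM_I_finite)
    also have "\<dots> = (\<integral>\<^sup>+x. (\<Prod>i\<in>I. f i (x i) * indicator (A i) (x i)) \<partial>PiM I M)"
    proof (rule nn_integral_cong)
      fix x assume "x \<in> space (PiM I M)"
      then have "indicator (Pi\<^sub>E I A) x = (\<Prod>i\<in>I. indicator (A i) (x i) :: ennreal)"
        using I by (auto simp: space_PiM PiE_def Pi_def indicator_def intro!: prod.neutral[symmetric] prod_zero[symmetric])
      then show "(\<Prod>i\<in>I. f i (x i)) * indicator (Pi\<^sub>E I A) x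
          = (\<Prod>i\<in>I. f i (x i) * indicator (A i) (x i))"
        by (simp add: prod.distrib)
    qed
    also have "\<dots> = (\<Prod>i\<in>I. \<integral>\<^sup>+x. f i x * indicator (A i) x \<partial>M i)"
      using I by (intro product_nn_integral_prod) auto
    also have "\<dots> = (\<Prod>i\<in>I. emeasure (density (M i) (f i)) (A i))"
      by (intro prod.cong) (auto simp: emeasure_density)
    finally show "emeasure (density (PiM I M) (\<lambda>x. \<Prod>i\<in>I. f i (x i))) (Pi\<^sub>E I A)
        = (\<Prod>i\<in>I. emeasure (density (M i) (f i)) (A i))" .
  qed
qed

text \<open>Independence makes the joint law the product of the marginal laws, hence a density with
  respect to the product of Lebesgue measures; it is then transported along the measure isomorphism
  between functions and vectors.\<close>

lemma (in prob_space) distributed_vec_indep: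
  fixes X :: "'t::finite \<Rightarrow> 'a \<Rightarrow> 'b::euclidean_space" and f :: "'t \<Rightarrow> 'b \<Rightarrow> ennreal"
  assumes indep: "indep_vars (\<lambda>_. borel) X UNIV"
    and X: "\<And>t. distributed M lborel (X t) (f t)"
  shows "distributed M lborel (\<lambda>\<omega>. \<chi> t. X t \<omega>) (\<lambda>x. \<Prod>t\<in>UNIV. f t (x $ t))"
  unfolding distributed_def
proof (intro conjI)
  have [measurable]: "X t \<in> borel_measurable M" "f t \<in> borel_measurable borel" for t
    using distributed_measurable[OF X, of t] distributed_borel_measurable[OF X, of t] by simp_all
  have vec[measurable]: "(\<lambda>f. \<chi> t. f t) \<in> (\<Pi>\<^sub>M t\<in>UNIV. lborel :: 'b measure) \<rightarrow>\<^sub>M (borel :: ('b^'t) measure)"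
    by (rule borel_measurable_vec_lambda)
  have [measurable]: "(\<lambda>x :: 'b^'t. x $ t) \<in> borel_measurable borel" for t
    by (intro borel_measurable_continuous_onI continuous_intros)
  have joint: "distr M (\<Pi>\<^sub>M t\<in>UNIV. lborel) (\<lambda>\<omega>. \<lambda>t\<in>UNIV. X t \<omega>)
      = (\<Pi>\<^sub>M t\<in>UNIV. distr M lborel (X t))"
    by (rule indep_vars_iff_distr_eq_PiM'[THEN iffD1])
      (use indep in \<open>auto simp: indep_vars_def cong: measurable_cong_sets\<close>)
  have sf: "sigma_finite_measure (density lborel (f t))" for t
    unfolding distributed_distr_eq_density[OF X, symmetric]
    by (intro finite_measure.axioms prob_space.axioms prob_space_distr) simp
  interpret product_sigma_finite "\<lambda>_::'t. lborel :: 'b measure"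
    by standard
  have X_PiM[measurable]: "(\<lambda>\<omega> t. X t \<omega>) \<in> M \<rightarrow>\<^sub>M (\<Pi>\<^sub>M t\<in>UNIV. lborel)"
    using measurable_restrict[of UNIV X M "\<lambda>_. lborel"] by (simp add: restrict_UNIV)
  show "(\<lambda>\<omega>. \<chi> t. X t \<omega>) \<in> M \<rightarrow>\<^sub>M lborel"
    using measurable_compose[OF X_PiM vec] by simp
  show "(\<lambda>x. \<Prod>t\<in>UNIV. f t (x $ t)) \<in> borel_measurable lborel"
    by simp
  have "distr M lborel (\<lambda>\<omega>. \<chi> t. X t \<omega>)
      = distr (distr M (\<Pi>\<^sub>M t\<in>UNIV. lborel) (\<lambda>\<omega>. \<lambda>t\<in>UNIV. X t \<omega>)) borel (\<lambda>f. \<chi> t. f t)"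
    by (subst distr_distr) (auto simp: o_def restrict_UNIV intro!: distr_cong)
  also have "\<dots> = distr (density (\<Pi>\<^sub>M t\<in>UNIV. lborel) (\<lambda>x. \<Prod>t\<in>UNIV. f t (x t))) borel (\<lambda>f. \<chi> t. f t)"
    unfolding joint by (simp add: distributed_distr_eq_density[OF X] PiM_density sf)
  also have "\<dots> = density (distr (\<Pi>\<^sub>M t\<in>UNIV. lborel) borel (\<lambda>f. \<chi> t. f t)) (\<lambda>x. \<Prod>t\<in>UNIV. f t (x $ t))"
    by (subst density_distr) auto
  finally show "distr M lborel (\<lambda>\<omega>. \<chi> t. X t \<omega>) = density lborel (\<lambda>x. \<Prod>t\<in>UNIV. f t (x $ t))"
    by (simp add: lborel_vec_eq_PiM)
qed

subsection \<open>Linear images and second moments of isotropic Gaussian vectors\<close>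

text \<open>The hypotheses make \<open>B \<circ> A\<close> the orthogonal projection onto the range
  of \<open>B\<close>, so Pythagoras splits the exponential into a function of
  \<open>x - B (A x)\<close> times a function of \<open>A x\<close>. The normalising constant stays
  an integral; no determinant is computed.\<close>

lemma distributed_gaussian_linear:
  fixes A :: "'a::euclidean_space \<Rightarrow> 'b::euclidean_space" and B :: "'b \<Rightarrow> 'a"
  assumes "prob_space M"
    and X: "distributed M lborel X (\<lambda>x. ennreal (c * exp (- (norm x)\<^sup>2 / s)))" and c: "0 \<le> c"
    and A: "linear A" and B: "linear B" and AB: "\<And>y. A (B y) = y"
    and orth: "\<And>x. orthogonal (x - B (A x)) (B (A x))"
  defines "Z \<equiv> \<integral>y. exp (- (norm (B y))\<^sup>2 / s) \<partial>lborel"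
  shows "0 < Z"
    and "distributed M lborel (\<lambda>\<omega>. A (X \<omega>)) (\<lambda>y. ennreal (exp (- (norm (B y))\<^sup>2 / s) / Z))"
proof -
  have "(\<lambda>x. ennreal (c * exp (- (norm x)\<^sup>2 / s)))
      = (\<lambda>x. ennreal (c * exp (- (norm (x - B (A x)))\<^sup>2 / s) * exp (- (norm (B (A x)))\<^sup>2 / s)))"
  proof
    fix x
    show "ennreal (c * exp (- (norm x)\<^sup>2 / s))
        = ennreal (c * exp (- (norm (x - B (A x)))\<^sup>2 / s) * exp (- (norm (B (A x)))\<^sup>2 / s))"
      using norm_add_Pythagorean[OF orth, of x] by (simp add: diff_divide_distrib mult.assoc flip: exp_add)
  qed
  with X have X': "distributed M lborel X (\<lambda>x. ennreal (c * exp (- (norm (x - B (A x)))\<^sup>2 / s)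
      * exp (- (norm (B (A x)))\<^sup>2 / s)))"
    by (rule back_subst)
  \<comment> \<open>For \<open>s = 0\<close> the quotient is 0 by convention and the function is
    constant; otherwise the usual continuity rules apply.\<close>
  have cont: "continuous_on UNIV (\<lambda>y. exp (- (norm (B y))\<^sup>2 / s))"
    using B by (cases "s = 0")
      (auto intro!: continuous_intros bounded_linear.continuous_on[of B]
        simp: linear_conv_bounded_linear)
  show "0 < Z"
    unfolding Z_def using c
    by (intro distributed_linear_projection(2)[OF \<open>prob_space M\<close> A B AB X' _ _ cont]) auto
  show "distributed M lborel (\<lambda>\<omega>. A (X \<omega>)) (\<lambda>y. ennreal (exp (- (norm (B y))\<^sup>2 / s) / Z))"
    unfolding Z_def using c
    by (intro distributed_linear_projection(3)[OF \<open>prob_space M\<close> A B AB X' _ _ cont]) auto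
qed

text \<open>The functional \<open>x \<bullet> u\<close> and the map \<open>y *\<^sub>R u\<close>
  satisfy the hypotheses on \<open>A\<close> and \<open>B\<close> in
  \<open>distributed_gaussian_linear\<close>, so the coordinate along \<open>u\<close> is a real
  centred normal variable, whose moments are known.\<close>

lemma (in prob_space) gaussian_second_moment_unit:
  fixes X :: "'a \<Rightarrow> 'b::euclidean_space"
  assumes X: "distributed M lborel X (\<lambda>x. ennreal (c * exp (- (norm x)\<^sup>2 / s)))" and c: "0 \<le> c"
    and s: "0 < s" and u: "norm u = 1"
  shows "integrable M (\<lambda>\<omega>. (X \<omega> \<bullet> u)\<^sup>2)" and "expectation (\<lambda>\<omega>. (X \<omega> \<bullet> u)\<^sup>2) = s / 2"
proof -
  \<comment> \<open>Chosen so that \<open>2 * \<tau>\<^sup>2 = s\<close>, which matches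
    \<open>exp (- y\<^sup>2 / s)\<close> with the exponent of
    \<open>normal_density 0 \<tau>\<close>.\<close>
  define \<tau> where "\<tau> = sqrt (s / 2)"
  have \<tau>: "0 < \<tau>" "\<tau>\<^sup>2 = s / 2" using s by (simp_all add: \<tau>_def)
  have uu: "u \<bullet> u = 1" using u by (simp add: dot_square_norm)
  have normal: "normal_density 0 \<tau> y = exp (- y\<^sup>2 / s) / sqrt (pi * s)" for y
    by (simp add: normal_density_def \<tau>)
  have dist: "distributed M lborel (\<lambda>\<omega>. X \<omega> \<bullet> u)
      (\<lambda>y. ennreal (exp (- (norm (y *\<^sub>R u))\<^sup>2 / s) / (\<integral>y. exp (- (norm (y *\<^sub>R u))\<^sup>2 / s) \<partial>lborel)))"
    by (rule distributed_gaussian_linear(2)[OF prob_space_axioms X c, of "\<lambda>x. x \<bullet> u"])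
      (auto simp: uu orthogonal_def algebra_simps intro!: linearI)
  \<comment> \<open>The Gaussian integral that normalises \<open>dist\<close> is read off from the
    total mass of the normal density.\<close>
  have "(\<integral>y. normal_density 0 \<tau> y \<partial>lborel) = 1"
    using \<tau> by simp
  then have "(\<integral>y. exp (- y\<^sup>2 / s) \<partial>lborel) = sqrt (pi * s)"
    using s unfolding normal by (simp split: if_splits)
  then have D: "distributed M lborel (\<lambda>\<omega>. X \<omega> \<bullet> u) (normal_density 0 \<tau>)"
    using dist by (simp add: u normal[abs_def])
  have "integrable M (\<lambda>\<omega>. (X \<omega> \<bullet> u)\<^sup>2) \<longleftrightarrow> integrable lborel (\<lambda>y. normal_density 0 \<tau> y * y\<^sup>2)"
    by (rule distributed_integrable[OF D, symmetric]) auto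
  then show "integrable M (\<lambda>\<omega>. (X \<omega> \<bullet> u)\<^sup>2)"
    using integrable_normal_moment[OF \<tau>(1), of 0 2] by simp
  show "expectation (\<lambda>\<omega>. (X \<omega> \<bullet> u)\<^sup>2) = s / 2"
    using normal_distributed_variance[OF \<tau>(1) D] normal_distributed_expectation[OF \<tau>(1) D] \<tau>
    by simp
qed

text \<open>Scaling extends the variance from unit vectors to all vectors, and polarisation turns
  variances into mixed moments.\<close>

lemma (in prob_space) gaussian_second_moment:
  fixes X :: "'a \<Rightarrow> 'b::euclidean_space"
  assumes X: "distributed M lborel X (\<lambda>x. ennreal (c * exp (- (norm x)\<^sup>2 / s)))" and c: "0 \<le> c"
    and s: "0 < s"
  shows "integrable M (\<lambda>\<omega>. (X \<omega> \<bullet> u) * (X \<omega> \<bullet> v))"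
    and "expectation (\<lambda>\<omega>. (X \<omega> \<bullet> u) * (X \<omega> \<bullet> v)) = s / 2 * (u \<bullet> v)"
proof -
  have sq: "integrable M (\<lambda>\<omega>. (X \<omega> \<bullet> w)\<^sup>2) \<and> expectation (\<lambda>\<omega>. (X \<omega> \<bullet> w)\<^sup>2) = s / 2 * (w \<bullet> w)" for w
  proof (cases "w = 0")
    case False
    define e where "e = w /\<^sub>R norm w"
    have e: "norm e = 1" using False by (simp add: e_def)
    have "w = norm w *\<^sub>R e" using False by (simp add: e_def)
    then have w: "(X \<omega> \<bullet> w)\<^sup>2 = (norm w)\<^sup>2 * (X \<omega> \<bullet> e)\<^sup>2" for \<omega>
      by (metis inner_scaleR_right power_mult_distrib)
    show ?thesis
      using gaussian_second_moment_unit[OF X c s e] by (simp add: w dot_square_norm)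
  qed simp
  have polar: "(X \<omega> \<bullet> u) * (X \<omega> \<bullet> v) = ((X \<omega> \<bullet> (u + v))\<^sup>2 - (X \<omega> \<bullet> (u - v))\<^sup>2) / 4" for \<omega>
    by (simp add: inner_add_right inner_diff_right power2_eq_square algebra_simps)
  show "integrable M (\<lambda>\<omega>. (X \<omega> \<bullet> u) * (X \<omega> \<bullet> v))"
    unfolding polar using sq by auto
  have "expectation (\<lambda>\<omega>. (X \<omega> \<bullet> u) * (X \<omega> \<bullet> v))
      = (s / 2 * ((u + v) \<bullet> (u + v)) - s / 2 * ((u - v) \<bullet> (u - v))) / 4"
    unfolding polar by (simp add: sq[THEN conjunct1] sq[THEN conjunct2])
  also have "\<dots> = s / 2 * (u \<bullet> v)"
    by (simp add: inner_add_left inner_add_right inner_diff_left inner_diff_right inner_commute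
        field_simps)
  finally show "expectation (\<lambda>\<omega>. (X \<omega> \<bullet> u) * (X \<omega> \<bullet> v)) = s / 2 * (u \<bullet> v)" .
qed

subsection \<open>Fisher information of a Gaussian location model\<close>

text \<open>Two densities of the same measure differ only on a null set; for continuous ones this
  set is open, and an open null set is empty. Hence the description in \<open>likelihood\<close> is
  well defined as soon as one continuous density is exhibited.\<close>

lemma is_continuous_density_unique:
  assumes f: "is_continuous_density P f" and g: "is_continuous_density P g"
  shows "f = g"
proof -
  have cont: "continuous_on UNIV f" "continuous_on UNIV g"
    and nonneg: "\<And>x. 0 \<le> f x" "\<And>x. 0 \<le> g x"
    using f g by (auto simp: is_continuous_density_def)
  note [measurable] = cont[THEN borel_measurable_continuous_onI]
  have "density lborel (\<lambda>x. ennreal (f x)) = density lborel (\<lambda>x. ennreal (g x))"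
    using f g by (simp add: is_continuous_density_def)
  then have "AE x in lborel. ennreal (f x) = ennreal (g x)"
    by (intro sigma_finite_measure.density_unique[OF sigma_finite_lborel]) auto
  then have "AE x in lborel. \<not> f x \<noteq> g x"
    using nonneg by simp
  then have null: "{x. f x \<noteq> g x} \<in> null_sets lborel"
    by (subst (asm) AE_iff_null) auto
  have "open {x. f x \<noteq> g x}"
    using cont by (rule open_Collect_neq)
  with null have "{x. f x \<noteq> g x} = {}"
    by (metis negligible_iff_null_sets null_sets_completionI open_not_negligible)
  then show ?thesis by auto
qed

lemma likelihood_eq: "is_continuous_density P f \<Longrightarrow> likelihood P = f"
  unfolding likelihood_def by (rule the_equality) (auto intro: is_continuous_density_unique)

lemma distributed_translate:
  fixes X :: "'w \<Rightarrow> 'b::euclidean_space"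
  assumes X: "distributed M lborel X f"
  shows "distributed M lborel (\<lambda>\<omega>. m + X \<omega>) (\<lambda>y. f (y - m))"
  unfolding distributed_def
proof (intro conjI)
  have [measurable]: "X \<in> borel_measurable M" "f \<in> borel_measurable borel"
    using distributed_measurable[OF X] distributed_borel_measurable[OF X] by simp_all
  show "(\<lambda>\<omega>. m + X \<omega>) \<in> M \<rightarrow>\<^sub>M lborel" "(\<lambda>y. f (y - m)) \<in> borel_measurable lborel"
    by simp_all
  have "distr M lborel (\<lambda>\<omega>. m + X \<omega>) = distr (distr M lborel X) borel ((+) m)"
    by (subst distr_distr) (auto simp: o_def intro!: distr_cong)
  also have "\<dots> = density (distr lborel borel ((+) m)) (\<lambda>y. f (y - m))"
    by (subst density_distr) (auto simp: distributed_distr_eq_density[OF X])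
  finally show "distr M lborel (\<lambda>\<omega>. m + X \<omega>) = density lborel (\<lambda>y. f (y - m))"
    by (simp add: lborel_distr_plus)
qed

text \<open>The laws are translates by \<open>A (\<mu> \<eta>)\<close> of one fixed density, so the
  log-likelihood is a quadratic form minus the constant \<open>ln Z\<close>, which differentiation
  removes. At the observation the score is linear in \<open>N\<close>, and the Fisher matrix reduces
  to second moments of \<open>N\<close>. Only derivatives of \<open>\<mu>\<close> along the
  coordinate lines through \<open>\<xi>\<close> enter.\<close>

lemma (in prob_space) fisher_information_gaussian_location:
  fixes N :: "'a \<Rightarrow> 'b::euclidean_space" and A :: "'b \<Rightarrow> 'c::euclidean_space"
    and \<mu> :: "real^'p \<Rightarrow> 'b"
  assumes N: "distributed M lborel N (\<lambda>x. ennreal (c * exp (- (norm x)\<^sup>2 / s)))"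
    and c: "0 \<le> c" and s: "0 < s"
    and A: "linear A" and B: "linear B" and AB: "\<And>y. A (B y) = y"
    and orth: "\<And>x y. orthogonal (x - B (A x)) (B y)"
    and \<mu>: "\<And>i. ((\<lambda>h. \<mu> (\<xi> + h *\<^sub>R axis i 1)) has_vector_derivative D i) (at 0)"
  defines "P \<equiv> \<lambda>\<eta>. distr M lborel (\<lambda>\<omega>. A (\<mu> \<eta> + N \<omega>))"
  shows "fisher_regular P \<xi>"
    and "fisher_information_matrix P \<xi> = (\<chi> i j. 2 / s * (D i \<bullet> B (A (D j))))"
proof -
  define Z where "Z = (\<integral>y. exp (- (norm (B y))\<^sup>2 / s) \<partial>lborel)"
  define f where "f \<eta> y = exp (- (norm (B (y - A (\<mu> \<eta>))))\<^sup>2 / s) / Z" for \<eta> y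
  note gaussian = distributed_gaussian_linear[OF prob_space_axioms N c A B AB orth, folded Z_def]
  have Z: "0 < Z" by (rule gaussian(1))
  have "distributed M lborel (\<lambda>\<omega>. A (\<mu> \<eta>) + A (N \<omega>)) (\<lambda>y. ennreal (f \<eta> y))" for \<eta>
    unfolding f_def by (rule distributed_translate[OF gaussian(2)])
  then have dist: "distributed M lborel (\<lambda>\<omega>. A (\<mu> \<eta> + N \<omega>)) (\<lambda>y. ennreal (f \<eta> y))" for \<eta>
    by (simp add: linear_add[OF A])
  have bl: "bounded_linear A" "bounded_linear B"
    using A B by (simp_all add: linear_conv_bounded_linear)
  have "continuous_on UNIV (f \<eta>)" for \<eta>
    unfolding f_def using Z s
    by (intro continuous_intros bounded_linear.continuous_on[OF bl(2)]) auto
  then have density: "is_continuous_density (P \<eta>) (f \<eta>)" for \<eta>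
    using Z distributed_distr_eq_density[OF dist, of \<eta>]
    by (auto simp: is_continuous_density_def P_def f_def)
  note likelihood = likelihood_eq[OF density]
  have ln_f: "ln (f \<eta> y) = - (B (y - A (\<mu> \<eta>)) \<bullet> B (y - A (\<mu> \<eta>))) / s - ln Z" for \<eta> y
    using Z by (simp add: f_def ln_div dot_square_norm)
  have deriv: "((\<lambda>h. ln (likelihood (P (\<xi> + h *\<^sub>R axis i 1)) y)) has_real_derivative
      2 / s * (B (y - A (\<mu> \<xi>)) \<bullet> B (A (D i)))) (at 0)" for i y
  proof -
    have "((\<lambda>h. B (y - A (\<mu> (\<xi> + h *\<^sub>R axis i 1)))) has_vector_derivative B (0 - A (D i))) (at 0)"
      by (intro bounded_linear.has_vector_derivative[OF bl(2)] has_vector_derivative_diff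
          has_vector_derivative_const bounded_linear.has_vector_derivative[OF bl(1)] \<mu>)
    then have "((\<lambda>h. B (y - A (\<mu> (\<xi> + h *\<^sub>R axis i 1)))) has_derivative (\<lambda>h. h *\<^sub>R B (0 - A (D i)))) (at 0)"
      by (simp add: has_vector_derivative_def)
    from has_derivative_inner[OF this this]
    have "((\<lambda>h. B (y - A (\<mu> (\<xi> + h *\<^sub>R axis i 1))) \<bullet> B (y - A (\<mu> (\<xi> + h *\<^sub>R axis i 1))))
        has_real_derivative 2 * (B (y - A (\<mu> \<xi>)) \<bullet> B (0 - A (D i)))) (at 0)"
      by (simp add: has_field_derivative_def inner_commute algebra_simps mult_commute_abs)
    then show ?thesis
      unfolding likelihood ln_f using s
      by (auto intro!: derivative_eq_intros simp: linear_neg[OF B] linear_0[OF B] linear_diff[OF B])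
  qed
  have score: "score P \<xi> y $ i = 2 / s * (B (y - A (\<mu> \<xi>)) \<bullet> B (A (D i)))" for y i
    by (simp add: score_def DERIV_imp_deriv[OF deriv])
  \<comment> \<open>The projection \<open>B \<circ> A\<close> may be dropped from one factor when
    the other lies in its range. This frees \<open>N\<close> from the projection in the score, and
    later the first of the two derivatives.\<close>
  have proj: "B (A x) \<bullet> B y = x \<bullet> B y" for x y
    using orth[of x y] by (simp add: orthogonal_def inner_diff_left)
  have score_at: "score P \<xi> (A (\<mu> \<xi> + N \<omega>)) $ i = 2 / s * (N \<omega> \<bullet> B (A (D i)))" for \<omega> i
    by (simp add: score linear_add[OF A] proj)
  have [measurable]: "A \<in> borel_measurable borel" "B \<in> borel_measurable borel"
    using A B by (simp_all add: borel_measurable_linear)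
  have [measurable]: "N \<in> borel_measurable M"
    using distributed_measurable[OF N] by simp
  have [measurable]: "(\<lambda>y. score P \<xi> y $ i) \<in> borel_measurable borel" for i
    unfolding score by measurable
  have prod: "score P \<xi> (A (\<mu> \<xi> + N \<omega>)) $ i * score P \<xi> (A (\<mu> \<xi> + N \<omega>)) $ j
      = (2 / s)\<^sup>2 * ((N \<omega> \<bullet> B (A (D i))) * (N \<omega> \<bullet> B (A (D j))))" for \<omega> i j
    by (simp add: score_at power2_eq_square)
  note moment = gaussian_second_moment[OF N c s]
  have int: "integrable (P \<xi>) (\<lambda>y. score P \<xi> y $ i * score P \<xi> y $ j)" for i j
    unfolding P_def
    by (subst integrable_distr_eq) (simp_all add: P_def[symmetric] prod moment(1))
  show "fisher_regular P \<xi>"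
    unfolding fisher_regular_def
  proof (intro conjI allI)
    show "\<exists>!f. is_continuous_density (P \<eta>) f" for \<eta>
      using density is_continuous_density_unique by blast
    show "0 < likelihood (P \<eta>) y" for \<eta> y
      using Z by (simp add: likelihood f_def)
    show "(\<lambda>h. ln (likelihood (P (\<xi> + h *\<^sub>R axis i 1)) y)) differentiable (at 0)" for y i
      using deriv[of i y] by (auto simp: has_field_derivative_def differentiable_def)
  qed (rule int)
  have "(\<integral>y. score P \<xi> y $ i * score P \<xi> y $ j \<partial>P \<xi>) = 2 / s * (D i \<bullet> B (A (D j)))" for i j
  proof -
    have "(\<integral>y. score P \<xi> y $ i * score P \<xi> y $ j \<partial>P \<xi>)
        = expectation (\<lambda>\<omega>. score P \<xi> (A (\<mu> \<xi> + N \<omega>)) $ i * score P \<xi> (A (\<mu> \<xi> + N \<omega>)) $ j)"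
      unfolding P_def by (rule integral_distr) (simp_all add: P_def[symmetric])
    \<comment> \<open>Each score contributes a factor \<open>2 / s\<close> and the second moment of
      \<open>N\<close> a factor \<open>s / 2\<close>, which leaves \<open>2 / s\<close>.\<close>
    also have "\<dots> = (2 / s)\<^sup>2 * (s / 2 * (D i \<bullet> B (A (D j))))"
      unfolding prod by (simp add: moment(2) proj)
    finally show ?thesis
      using s by (simp add: power2_eq_square)
  qed
  then show "fisher_information_matrix P \<xi> = (\<chi> i j. 2 / s * (D i \<bullet> B (A (D j))))"
    by (simp add: fisher_information_matrix_def)
qed

subsection \<open>Complex matrices, pseudo-inverses and orthogonal projectors\<close>

text \<open>Densities and derivatives live on the underlying real Euclidean space, whereas
  projectors and matrices use the Hermitian form. This passage between the two is the source of the
  real part in the Fisher matrix.\<close>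

lemma inner_eq_Re_hinner: "inner x y = Re (hinner x y)" for x y :: "complex^'n"
  by (simp add: hinner_def inner_vec_def inner_complex_def)

lemma hinner_self: "hinner x x = complex_of_real ((norm x)\<^sup>2)"
proof -
  have "hinner x x = complex_of_real (\<Sum>i\<in>UNIV. (cmod (x $ i))\<^sup>2)"
    unfolding hinner_def of_real_sum
    by (rule sum.cong[OF refl]) (simp only: complex_norm_square mult.commute)
  then show ?thesis
    by (simp add: norm_vec_def L2_set_def sum_nonneg)
qed

lemma conj_transpose_nth [simp]: "conj_transpose A $ i $ j = cnj (A $ j $ i)"
  by (simp add: conj_transpose_def map_matrix_def transpose_def)

lemma hinner_conj_transpose_left: "hinner (conj_transpose A *v x) y = hinner x (A *v y)"
proof -
  have "hinner (conj_transpose A *v x) y = (\<Sum>i\<in>UNIV. \<Sum>j\<in>UNIV. cnj (x $ j) * (A $ j $ i * y $ i))"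
    by (simp add: hinner_def matrix_vector_mult_def sum_distrib_right mult.assoc mult.left_commute)
  also have "\<dots> = (\<Sum>j\<in>UNIV. \<Sum>i\<in>UNIV. cnj (x $ j) * (A $ j $ i * y $ i))"
    by (rule sum.swap)
  also have "\<dots> = hinner x (A *v y)"
    by (simp add: hinner_def matrix_vector_mult_def sum_distrib_left)
  finally show ?thesis .
qed

lemma conj_transpose_mult: "conj_transpose (A ** B) = conj_transpose B ** conj_transpose A"
  by (simp add: vec_eq_iff matrix_matrix_mult_def mult.commute)

lemma conj_transpose_conj_transpose [simp]: "conj_transpose (conj_transpose A) = A"
  by (simp add: vec_eq_iff)

lemma conj_transpose_mat_1 [simp]: "conj_transpose (mat 1) = mat 1"
  by (simp add: vec_eq_iff mat_def)

text \<open>Since \<open>rows G\<close> is a set, equal rows would collapse. Rank equal to the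
  number of row indices forces the rows to be distinct as well as independent, and independence of
  the indexed family of rows is equivalent to the existence of a right inverse.\<close>

lemma full_row_rank_right_inverse:
  fixes G :: "'a::field^'n^'m"
  assumes rank: "rank G = CARD('m)"
  obtains R where "G ** R = mat 1"
proof -
  have rows: "rows G = range (\<lambda>i. row i G)"
    by (auto simp: rows_def)
  have "finite (rows G)"
    by (simp add: rows)
  moreover have "card (rows G) \<le> CARD('m)"
    unfolding rows by (rule card_image_le) simp
  ultimately have card: "card (rows G) = CARD('m)"
    using rank vec.dim_le_card[OF vec.span_superset, of "rows G"] by (simp add: row_rank_def_gen)
  then have inj: "inj (\<lambda>i. row i G)"
    unfolding rows by (rule eq_card_imp_inj_on[OF finite])
  have indep: "vec.independent (rows G)"
    using vec.card_eq_dim[OF subset_refl, of "rows G"] card rank \<open>finite (rows G)\<close>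
    by (simp add: row_rank_def_gen vec.span_superset)
  have "\<forall>i. c i = 0" if c: "(\<Sum>i\<in>UNIV. c i *s row i G) = 0" for c
  proof
    fix i
    \<comment> \<open>Coefficients indexed by positions are turned into coefficients indexed by the
      row vectors, as set-based independence requires.\<close>
    have "(\<Sum>v\<in>rows G. c (the_inv (\<lambda>i. row i G) v) *s v) = 0"
      unfolding rows using c by (simp add: sum.reindex[OF inj] the_inv_f_f[OF inj])
    from vec.independentD[OF indep \<open>finite (rows G)\<close> subset_refl this, of "row i G"]
    have "c (the_inv (\<lambda>i. row i G) (row i G)) = 0"
      by (simp add: rows)
    then show "c i = 0"
      by (simp add: the_inv_f_f[OF inj])
  qed
  then have "\<exists>R. G ** R = mat 1"
    unfolding matrix_right_invertible_independent_rows by (rule allI[OF impI])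
  then show ?thesis
    using that by (elim exE)
qed

text \<open>\<open>W\<close> is the inverse of the Gram matrix \<open>G ** conj_transpose G\<close>.
  If that matrix kills \<open>x\<close>, then the squared norm of
  \<open>conj_transpose G *v x\<close> is 0, and pairing this vector with \<open>R *v x\<close>
  gives \<open>hinner x x = 0\<close>.\<close>

lemma full_row_rank_pseudo_inverse:
  fixes G :: "complex^'n^'m"
  assumes rank: "rank G = CARD('m)"
  obtains W where "G ** (conj_transpose G ** W) = mat 1" "conj_transpose W = W"
proof -
  obtain R where R: "G ** R = mat 1"
    using rank by (rule full_row_rank_right_inverse)
  have "x = 0" if "(G ** conj_transpose G) *v x = 0" for x
  proof -
    have "hinner (conj_transpose G *v x) (conj_transpose G *v x) = hinner x ((G ** conj_transpose G) *v x)"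
      by (simp add: hinner_conj_transpose_left matrix_vector_mul_assoc)
    then have "conj_transpose G *v x = 0"
      using that by (simp add: hinner_self) (simp add: hinner_def)
    then have "hinner (conj_transpose G *v x) (R *v x) = 0"
      by (simp add: hinner_def)
    then have "hinner x (G *v (R *v x)) = 0"
      by (simp add: hinner_conj_transpose_left)
    then show ?thesis
      by (simp add: matrix_vector_mul_assoc R hinner_self)
  qed
  then obtain V where V: "V ** (G ** conj_transpose G) = mat 1"
    using matrix_left_invertible_ker[of "G ** conj_transpose G"] by blast
  then have W: "(G ** conj_transpose G) ** V = mat 1"
    by (rule matrix_left_right_inverse[THEN iffD1])
  \<comment> \<open>The inverse of a Hermitian matrix is Hermitian: the Gram matrix is inserted next
    to \<open>V\<close> and then absorbed on the other side.\<close>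
  have "conj_transpose V = conj_transpose V ** ((G ** conj_transpose G) ** V)"
    by (simp add: W)
  also have "\<dots> = conj_transpose ((G ** conj_transpose G) ** V) ** V"
    by (simp add: conj_transpose_mult matrix_mul_assoc)
  also have "\<dots> = V"
    by (simp add: W)
  finally show ?thesis
    using that[of V] W by (simp add: matrix_mul_assoc)
qed

text \<open>For a second candidate \<open>Q\<close>, the difference of \<open>Q *v x\<close> and
  \<open>P *v x\<close> lies in \<open>S\<close> and is orthogonal to both residuals, hence to their
  difference, which is that same vector.\<close>

lemma orthogonal_projector_eqI:
  assumes S: "vec.subspace S"
    and P: "\<And>x. P *v x \<in> S" "\<And>x y. y \<in> S \<Longrightarrow> hinner y (x - P *v x) = 0"
  shows "orthogonal_projector S = P"
  unfolding orthogonal_projector_def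
proof (rule the_equality)
  fix Q assume Q: "\<forall>x. Q *v x \<in> S \<and> (\<forall>y\<in>S. hinner y (x - Q *v x) = 0)"
  have "Q *v x = P *v x" for x
  proof -
    define d where "d = Q *v x - P *v x"
    have "d \<in> S"
      using Q P(1) S by (simp add: d_def vec.subspace_diff)
    then have "hinner d (x - P *v x) = 0" "hinner d (x - Q *v x) = 0"
      using Q P(2) by auto
    then have "hinner d (x - P *v x) - hinner d (x - Q *v x) = 0"
      by simp
    also have "hinner d (x - P *v x) - hinner d (x - Q *v x) = hinner d d"
      unfolding hinner_def by (simp add: d_def algebra_simps flip: sum_subtractf)
    finally show ?thesis
      by (simp add: hinner_self d_def)
  qed
  then show "Q = P"
    by (simp add: matrix_eq)
qed (use P in auto)

text \<open>The values lie in the column space of \<open>conj_transpose G\<close> because that is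
  the leftmost factor. The hypothesis on \<open>W\<close> gives that \<open>G\<close> kills the
  residual, which is orthogonality to the columns of \<open>conj_transpose G\<close>.\<close>

lemma orthogonal_projector_row_space:
  assumes W: "G ** (conj_transpose G ** W) = mat 1"
  shows "orthogonal_projector (row_space G) = conj_transpose G ** W ** G"
proof (rule orthogonal_projector_eqI)
  show "vec.subspace (row_space G)"
    by (simp add: row_space_def col_space_def vec.subspace_span)
  show "(conj_transpose G ** W ** G) *v x \<in> row_space G" for x
    unfolding row_space_def col_space_def
    using matrix_vector_mult_in_columnspace_gen[of "conj_transpose G" "W *v (G *v x)"]
    by (simp add: matrix_vector_mul_assoc matrix_mul_assoc)
  fix x y assume "y \<in> row_space G"
  moreover have "hinner (column i (conj_transpose G)) (x - (conj_transpose G ** W ** G) *v x) = 0" for i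
  proof -
    have "column i (conj_transpose G) = conj_transpose G *v axis i 1"
      by (simp add: vec_eq_iff column_def matrix_vector_mult_def axis_def if_distrib cong: if_cong)
    moreover have "G *v (x - (conj_transpose G ** W ** G) *v x) = 0"
      using W by (simp add: matrix_vector_mult_diff_distrib matrix_vector_mul_assoc matrix_mul_assoc)
    ultimately show ?thesis
      by (simp add: hinner_conj_transpose_left) (simp add: hinner_def)
  qed
  ultimately show "hinner y (x - (conj_transpose G ** W ** G) *v x) = 0"
    unfolding row_space_def col_space_def
  \<comment> \<open>Orthogonality passes from the columns to their span; \<open>hinner\<close> is
    conjugate-linear in its first argument, so scalars come out as \<open>cnj c\<close>.\<close>
  proof (induction rule: vec.span_induct_alt)
    case base
    then show ?case by (simp add: hinner_def)
  next
    case (step c v w)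
    then have "hinner v (x - (conj_transpose G ** W ** G) *v x) = 0"
      by (auto simp: columns_def)
    moreover have "hinner (c *s v + w) z = cnj c * hinner v z + hinner w z" for z
      by (simp add: hinner_def algebra_simps sum.distrib sum_distrib_left)
    ultimately show ?case
      using step by simp
  qed
qed

subsection \<open>The array model\<close>

lemma linear_matrix_blocks: "linear (\<lambda>x :: complex^'n^'t. \<chi> t. G *v x $ t)"
  by (rule linearI)
    (simp_all add: vec_eq_iff matrix_vector_mult_def sum.distrib algebra_simps scaleR_sum_right)

lemma has_vector_derivative_vec:
  fixes f :: "real \<Rightarrow> 'a::euclidean_space^'t"
  assumes "\<And>t. ((\<lambda>h. f h $ t) has_vector_derivative f' $ t) (at x)"
  shows "(f has_vector_derivative f') (at x)"
  unfolding has_vector_derivative_def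
proof (subst has_derivative_componentwise_within, intro ballI)
  fix b :: "'a^'t" assume "b \<in> Basis"
  then obtain t u where b: "b = axis t u" by (auto simp: Basis_vec_def)
  have "((\<lambda>h. f h $ t) has_derivative (\<lambda>h. h *\<^sub>R f' $ t)) (at x)"
    using assms by (simp add: has_vector_derivative_def)
  then show "((\<lambda>h. f h \<bullet> b) has_derivative (\<lambda>h. h *\<^sub>R f' \<bullet> b)) (at x)"
    unfolding b inner_axis by (auto intro!: derivative_eq_intros)
qed

text \<open>The Jacobian is defined through \<open>vector_derivative\<close>, which is meaningful
  only where a derivative exists. All three kinds of parameter are treated at once: coordinate
  \<open>q\<close> moves at rate \<open>axis p 1 $ q\<close>, and the product rule does the
  rest.\<close>

lemma mean_signal_differentiable:
  fixes \<xi> :: "real^('k::finite param)"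
  assumes "\<And>x. a differentiable (at x)"
  shows "(\<lambda>h. mean_signal a s (\<xi> + h *\<^sub>R axis p 1) t) differentiable (at 0)"
proof -
  let ?x = "\<lambda>q h. \<xi> $ q + h * axis p 1 $ q"
  have coord: "(?x q has_vector_derivative axis p 1 $ q) (at 0)" for q
    unfolding has_real_derivative_iff_has_vector_derivative[symmetric]
    by (auto intro!: derivative_eq_intros)
  define a' where "a' = (\<lambda>k. vector_derivative a (at (\<xi> $ Angle k)))"
  define g' where "g' = (\<lambda>k. Complex (axis p 1 $ ReGain k) (axis p 1 $ ImGain k))"
  have "((\<lambda>h. a (?x (Angle k) h)) has_vector_derivative axis p 1 $ Angle k *\<^sub>R a' k) (at 0)" for k
    using vector_diff_chain_at[OF coord, of a "a' k" "Angle k"] assms vector_derivative_works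
    by (auto simp: a'_def o_def)
  then have a_deriv: "((\<lambda>h. a (?x (Angle k) h) $ i) has_vector_derivative
      (axis p 1 $ Angle k *\<^sub>R a' k) $ i) (at 0)" for k i
    by (rule bounded_linear.has_vector_derivative[OF bounded_linear_vec_nth])
  have Complex: "Complex u v = u *\<^sub>R 1 + v *\<^sub>R \<i>" for u v
    by (simp add: complex_eq_iff)
  have gain_deriv: "((\<lambda>h. Complex (?x (ReGain k) h) (?x (ImGain k) h)) has_vector_derivative g' k) (at 0)" for k
    unfolding Complex g'_def
    by (intro has_vector_derivative_add
        bounded_linear.has_vector_derivative[OF bounded_linear_scaleR_left coord])
  have "((\<lambda>h. mean_signal a s (\<xi> + h *\<^sub>R axis p 1) t) has_vector_derivative
      (\<chi> i. s t * (\<Sum>k\<in>UNIV. a (?x (Angle k) 0) $ i * g' k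
        + (axis p 1 $ Angle k *\<^sub>R a' k) $ i * Complex (?x (ReGain k) 0) (?x (ImGain k) 0)))) (at 0)"
    by (rule has_vector_derivative_vec)
      (simp only: mean_signal_nth vec_lambda_beta vector_add_component vector_scaleR_component
        real_scaleR_def,
        intro has_vector_derivative_mult_right has_vector_derivative_sum has_vector_derivative_mult
          a_deriv[unfolded vector_scaleR_component] gain_deriv)
  then show ?thesis
    by (rule differentiableI_vector)
qed

text \<open>Column \<open>p\<close> of the Jacobian, reshaped into one vector per snapshot, serves
  as the derivative \<open>D p\<close> of the Gaussian location model.\<close>

lemma mean_signal_has_vector_derivative:
  fixes \<xi> :: "real^('k::finite param)"
  assumes "\<And>x. a differentiable (at x)"
  shows "((\<lambda>h. \<chi> t. mean_signal a s (\<xi> + h *\<^sub>R axis p 1) t) has_vector_derivative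
    (\<chi> t i. digital_jacobian a s \<xi> $ (t, i) $ p)) (at 0)"
proof (rule has_vector_derivative_vec)
  fix t
  have "(\<chi> i. digital_jacobian a s \<xi> $ (t, i) $ p)
      = vector_derivative (\<lambda>h. mean_signal a s (\<xi> + h *\<^sub>R axis p 1) t) (at 0)"
    by (simp add: digital_jacobian_def vec_eq_iff)
  then show "((\<lambda>h. (\<chi> t. mean_signal a s (\<xi> + h *\<^sub>R axis p 1) t) $ t) has_vector_derivative
      (\<chi> t i. digital_jacobian a s \<xi> $ (t, i) $ p) $ t) (at 0)"
    using mean_signal_differentiable[OF assms, THEN vector_derivative_works[THEN iffD1]] by simp
qed

lemma sum_UNIV_prod: "(\<Sum>c\<in>UNIV. f c) = (\<Sum>t\<in>UNIV. \<Sum>i\<in>UNIV. f (t, i))"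
  by (simp add: sum.cartesian_product flip: UNIV_Times_UNIV)

lemma kronecker_mat_1_mult_nth:
  fixes J :: "complex^'p^('t::finite \<times> 'n::finite)"
  shows "(kronecker (mat 1) P ** J) $ (t, i) $ q = (P *v (\<chi> j. J $ (t, j) $ q)) $ i"
proof -
  have "(\<Sum>j\<in>UNIV. kronecker (mat 1) P $ (t, i) $ (t', j) * J $ (t', j) $ q)
      = (if t' = t then (P *v (\<chi> j. J $ (t, j) $ q)) $ i else 0)" for t'
    by (simp add: kronecker_def mat_def matrix_vector_mult_def)
  then show ?thesis
    by (simp add: matrix_matrix_mult_def sum_UNIV_prod)
qed

text \<open>Since \<open>kronecker (mat 1) P\<close> is block diagonal, the quadratic form is a sum
  over snapshots of Hermitian products. This identifies the matrix formula with the entries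
  \<open>D i \<bullet> B (A (D j))\<close> of the location model.\<close>

lemma Re_quadratic_kronecker:
  fixes J :: "complex^'p^('t::finite \<times> 'n::finite)"
  shows "Re ((conj_transpose J ** kronecker (mat 1) P ** J) $ p $ q)
    = (\<chi> t i. J $ (t, i) $ p) \<bullet> (\<chi> t. P *v (\<chi> i. J $ (t, i) $ q))"
proof -
  have "(conj_transpose J ** (kronecker (mat 1) P ** J)) $ p $ q
      = (\<Sum>t\<in>UNIV. hinner (\<chi> i. J $ (t, i) $ p) (P *v (\<chi> i. J $ (t, i) $ q)))"
    unfolding matrix_matrix_mult_def[of "conj_transpose J"]
    by (simp add: sum_UNIV_prod kronecker_mat_1_mult_nth hinner_def)
  then show ?thesis
    by (simp add: matrix_mul_assoc inner_vec_def[of "vec_lambda _"] inner_eq_Re_hinner)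
qed

lemma kronecker_mat_1_mat_1: "kronecker (mat 1) (mat 1) = mat 1"
  by (auto simp: kronecker_def mat_def vec_eq_iff)

text \<open>The inverse of a scalar matrix is scalar and its determinant is a power. The exponent
  carries no factor 1/2, so each real coordinate has variance \<open>v / 2\<close>, in agreement
  with the second moments above.\<close>

lemma complex_normal_density_isotropic:
  fixes x :: "complex^'n"
  assumes "0 < v"
  shows "complex_normal_density 0 (mat (complex_of_real v)) x
    = 1 / (pi * v) ^ CARD('n) * exp (- (norm x)\<^sup>2 / v)"
proof -
  let ?V = "mat (complex_of_real v) :: complex^'n^'n"
  have mat_mult: "mat c *v y = c *s y" for c :: complex and y :: "complex^'n"
    by (simp add: vec_eq_iff matrix_vector_mult_def mat_def if_distrib if_distribR cong: if_cong)
  have "?V ** mat (1 / complex_of_real v) = mat 1"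
    using assms by (simp add: matrix_eq mat_mult flip: matrix_vector_mul_assoc)
  then have "invertible ?V"
    by (auto simp: invertible_right_inverse)
  \<comment> \<open>\<open>matrix_inv\<close> is a choice among inverses, so its defining property
    is available only once invertibility is known.\<close>
  then have "?V ** matrix_inv ?V = mat 1"
    unfolding invertible_def matrix_inv_def by (rule someI2_ex) simp
  then have "?V *v (matrix_inv ?V *v x) = x"
    by (simp add: matrix_vector_mul_assoc)
  then have "matrix_inv ?V *v x = (1 / complex_of_real v) *s x"
    using assms by (auto simp: mat_mult vec_eq_iff field_simps)
  then have "hinner x (matrix_inv ?V *v x) = hinner x x / complex_of_real v"
    by (simp add: hinner_def sum_divide_distrib)
  then have "Re (hinner x (matrix_inv ?V *v x)) = (norm x)\<^sup>2 / v"
    by (simp add: hinner_self flip: of_real_divide)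
  moreover have "Re (det ?V) = v ^ CARD('n)"
    by (subst det_diagonal) (simp_all add: mat_def flip: of_real_power)
  ultimately show ?thesis
    by (simp add: complex_normal_density_def power_mult_distrib)
qed

lemma (in prob_space) distributed_noise_stack:
  fixes n :: "'t::finite \<Rightarrow> 'a \<Rightarrow> complex^'n"
  assumes v: "0 < v"
    and noise_law: "\<And>t. distributed M lborel (n t)
      (\<lambda>x. ennreal (complex_normal_density 0 (mat (complex_of_real v)) x))"
    and noise_indep: "indep_vars (\<lambda>_. borel) n UNIV"
  shows "distributed M lborel (\<lambda>\<omega>. \<chi> t. n t \<omega>)
    (\<lambda>x. ennreal ((1 / (pi * v) ^ CARD('n)) ^ CARD('t) * exp (- (norm x)\<^sup>2 / v)))"
proof -
  have "(\<Prod>t\<in>UNIV. ennreal (complex_normal_density 0 (mat (complex_of_real v)) (x $ t)))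
      = ennreal ((1 / (pi * v) ^ CARD('n)) ^ CARD('t) * exp (- (norm x)\<^sup>2 / v))"
    for x :: "complex^'n^'t"
  proof -
    have "(norm x)\<^sup>2 = (\<Sum>t\<in>UNIV. (norm (x $ t))\<^sup>2)"
      by (simp add: norm_vec_def L2_set_def sum_nonneg)
    then have "(\<Sum>t\<in>UNIV. - (norm (x $ t))\<^sup>2 / v) = - (norm x)\<^sup>2 / v"
      by (simp add: sum_negf flip: sum_divide_distrib)
    then have "(\<Prod>t\<in>UNIV. exp (- (norm (x $ t))\<^sup>2 / v)) = exp (- (norm x)\<^sup>2 / v)"
      by (simp flip: exp_sum)
    then show ?thesis
      using v by (simp add: complex_normal_density_isotropic prod_ennreal prod.distrib prod_dividef
          power_one_over)
  qed
  then show ?thesis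
    using distributed_vec_indep[OF noise_indep noise_law] by simp
qed

text \<open>A right inverse \<open>R\<close> makes \<open>R ** G\<close> idempotent; together with
  the Hermitian condition this makes it an orthogonal projection. Keeping \<open>R\<close> abstract
  covers the pseudo-inverse and the identity by one argument.\<close>

lemma (in prob_space) fisher_information_milac:
  fixes n :: "'t::finite \<Rightarrow> 'a \<Rightarrow> complex^'n"
    and \<xi> :: "real^('k::finite param)" and G :: "complex^'n^'l"
  assumes v: "0 < v"
    and noise_law: "\<And>t. distributed M lborel (n t)
      (\<lambda>x. ennreal (complex_normal_density 0 (mat (complex_of_real v)) x))"
    and noise_indep: "indep_vars (\<lambda>_. borel) n UNIV"
    and steering: "\<And>x. a differentiable (at x)"
    and GR: "G ** R = mat 1" and hermitian: "conj_transpose (R ** G) = R ** G"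
  shows "fisher_regular (milac_law M n a s G) \<xi>"
    and "fisher_information_matrix (milac_law M n a s G) \<xi> = (2 / v) *\<^sub>R map_matrix Re
      (conj_transpose (digital_jacobian a s \<xi>) ** kronecker (mat 1) (R ** G) ** digital_jacobian a s \<xi>)"
proof -
  define A :: "complex^'n^'t \<Rightarrow> complex^'l^'t" where "A = (\<lambda>x. \<chi> t. G *v x $ t)"
  define B :: "complex^'l^'t \<Rightarrow> complex^'n^'t" where "B = (\<lambda>y. \<chi> t. R *v y $ t)"
  have A: "linear A" and B: "linear B"
    unfolding A_def B_def by (rule linear_matrix_blocks)+
  have AB: "A (B y) = y" for y
    by (simp add: A_def B_def matrix_vector_mul_assoc GR)
  have BA: "B (A x) = (\<chi> t. (R ** G) *v x $ t)" for x
    by (simp add: A_def B_def matrix_vector_mul_assoc)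
  have orth: "orthogonal (x - B (A x)) (B y)" for x y
  proof -
    have sym: "(B (A z)) \<bullet> w = z \<bullet> B (A w)" for z w
      using hinner_conj_transpose_left[of "R ** G"]
      by (simp add: BA inner_vec_def[of "vec_lambda _"] inner_vec_def[of z] inner_eq_Re_hinner hermitian)
    \<comment> \<open>Self-adjointness moves the projection onto the residual, which
      \<open>A\<close> sends to 0.\<close>
    have "(x - B (A x)) \<bullet> B (A (B y)) = B (A (x - B (A x))) \<bullet> B y"
      by (rule sym[symmetric])
    also have "\<dots> = 0"
      by (simp add: linear_diff[OF A] linear_0[OF B] AB)
    finally show ?thesis
      by (simp add: orthogonal_def AB)
  qed
  have law: "milac_law M n a s G
      = (\<lambda>\<eta>. distr M lborel (\<lambda>\<omega>. A ((\<chi> t. mean_signal a s \<eta> t) + (\<chi> t. n t \<omega>))))"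
    by (simp add: milac_law_def[abs_def] A_def matrix_vector_right_distrib)
  have c: "0 \<le> (1 / (pi * v) ^ CARD('n)) ^ CARD('t)"
    using v by simp
  note fisher = fisher_information_gaussian_location[OF
      distributed_noise_stack[OF v noise_law noise_indep] c v A B AB orth
      mean_signal_has_vector_derivative[OF steering], of s, folded law]
  show "fisher_regular (milac_law M n a s G) \<xi>"
    by (rule fisher(1))
  show "fisher_information_matrix (milac_law M n a s G) \<xi> = (2 / v) *\<^sub>R map_matrix Re
      (conj_transpose (digital_jacobian a s \<xi>) ** kronecker (mat 1) (R ** G) ** digital_jacobian a s \<xi>)"
    unfolding fisher(2) by (simp add: vec_eq_iff map_matrix_def Re_quadratic_kronecker BA)
qed

theorem theorem1:
  fixes M :: "'w measure"
    and n :: "'t::finite \<Rightarrow> 'w \<Rightarrow> complex^'n"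
    and a :: "real \<Rightarrow> complex^'n"
    and s :: "'t \<Rightarrow> complex"
    and \<sigma> :: real
    and \<xi> :: "real^('k::finite param)"
    and G :: "complex^'n^'l"
  assumes prob: "prob_space M"
    and sigma: "0 < \<sigma>\<^sup>2"
    and noise_law: "\<And>t. distributed M lborel (n t)
          (\<lambda>x. ennreal (complex_normal_density 0 (mat (complex_of_real (\<sigma>\<^sup>2))) x))"
    and noise_indep: "prob_space.indep_vars M (\<lambda>_. borel) n UNIV"
    and steering: "\<And>x. a differentiable (at x)"
    and distinct_angles: "inj (\<lambda>k. angles \<xi> $ k)"
    and nonzero_gains: "\<And>k. gains \<xi> $ k \<noteq> 0"
    and dims: "CARD('l) \<le> CARD('n)"
    and full_rank: "rank G = CARD('l)"
  shows "(let J_milac = fisher_information_matrix (milac_law M n a s G) \<xi>;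
              J_dig = fisher_information_matrix (digital_law M n a s) \<xi>;
              Jac = digital_jacobian a s \<xi>;
              P = orthogonal_projector (row_space G)
          in fisher_regular (milac_law M n a s G) \<xi> \<and>
             fisher_regular (digital_law M n a s) \<xi> \<and>
             J_milac = (2 / \<sigma>\<^sup>2) *\<^sub>R map_matrix Re (conj_transpose Jac ** kronecker (mat 1) P ** Jac) \<and>
             J_dig = (2 / \<sigma>\<^sup>2) *\<^sub>R map_matrix Re (conj_transpose Jac ** Jac) \<and>
             (P = mat 1 \<longrightarrow> J_milac = J_dig))"
proof -
  interpret prob_space M by (rule prob)
  obtain W where W: "G ** (conj_transpose G ** W) = mat 1" and W_hermitian: "conj_transpose W = W"
    using full_rank by (rule full_row_rank_pseudo_inverse)
  have hermitian: "conj_transpose (conj_transpose G ** W ** G) = conj_transpose G ** W ** G"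
    by (simp add: conj_transpose_mult W_hermitian matrix_mul_assoc)
  \<comment> \<open>Here \<open>R\<close> is \<open>conj_transpose G ** W\<close>, so
    \<open>R ** G\<close> is literally the expression found for the projector onto the row
    space.\<close>
  note milac = fisher_information_milac[OF sigma noise_law noise_indep steering W hermitian,
      where s = s and \<xi> = \<xi>]
  have digital_law: "digital_law M n a s = milac_law M n a s (mat 1)"
    by (simp add: digital_law_def[abs_def] milac_law_def[abs_def])
  note digital = fisher_information_milac[OF sigma noise_law noise_indep steering,
      where G = "mat 1" and R = "mat 1" and s = s and \<xi> = \<xi>, folded digital_law]
  show ?thesis
    using milac digital
    by (simp add: Let_def orthogonal_projector_row_space[OF W] kronecker_mat_1_mat_1)
qed

end
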